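(* Let $A\subseteq \mathbb{F}_5^2$ be a sum-free set with $|A|\ge 5$. If $A$ is not normal, then $A$ is isomorphic to one of the following two sets (with coordinates in $\mathbb{F}_5=\{-2,-1,0,1,2\}$): $$\{(-2,1),(-1,1),(0,1),(1,1),(1,-2)\}\quad\text{or}\quad \{(-1,1),(0,1),(1,1),(1,-2),(-1,-1)\}.$$
   Context: A subset $A$ of an abelian group is sum-free if there are no (not necessarily distinct) $x,y,z\in A$ with $x+y=z$. A sum-free set $A\subseteq\mathbb{F}_5^n$ is called normal if $A\subseteq H\cup(-H)$ for some affine hyperplane $H\subseteq \mathbb{F}_5^n$ not containing the origin (for $n=2$, an affine line not through the origin). Two subsets of $\mathbb{F}_5^2$ are isomorphic if some linear automorphism of $\mathbb{F}_5^2$ maps one onto the other. *)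

theory Defs
  imports "HOL-Analysis.Analysis"
begin

definition sum_free :: "'a::ab_group_add set \<Rightarrow> bool" where
  "sum_free A \<longleftrightarrow> (\<nexists>x y z. x \<in> A \<and> y \<in> A \<and> z \<in> A \<and> x + y = z)"

definition affine_hyperplane :: "('a::field ^ 'n) set \<Rightarrow> bool" where
  "affine_hyperplane H \<longleftrightarrow>
     (\<exists>W v. vec.subspace W \<and> vec.dim W + 1 = CARD('n) \<and> H = (+) v ` W)"

definition normal_sum_free :: "('a::field ^ 'n) set \<Rightarrow> bool" where
  "normal_sum_free A \<longleftrightarrow>
     sum_free A \<and> (\<exists>H. affine_hyperplane H \<and> 0 \<notin> H \<and> A \<subseteq> H \<union> uminus ` H)"

definition linearly_isomorphic :: "('a::field ^ 'n) set \<Rightarrow> ('a ^ 'n) set \<Rightarrow> bool" where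
  "linearly_isomorphic A B \<longleftrightarrow>
     (\<exists>f. Vector_Spaces.linear (*s) (*s) f \<and> bij f \<and> f ` A = B)"

end

theory Submission
  imports Defs "HOL-Number_Theory.Residues"
begin

text \<open>
  A sum-free set meets a line through the origin in at most two points \<open>\<plusminus>a\<close>. If \<open>A\<close> contains no
  \<open>a, b, c\<close> with \<open>a + b + c = 0\<close>, then \<open>A \<union> -A\<close> is again sum-free; in coordinates with respect to
  two independent elements of \<open>A\<close>, one of the functionals \<open>s + t\<close> and \<open>s - t\<close> takes only the values
  \<open>\<plusminus>1\<close> on it, so \<open>A\<close> is normal. Otherwise \<open>A\<close> contains \<open>a\<close>, \<open>b\<close> and \<open>c = -a - b\<close>, and all its
  other elements are among \<open>\<plusminus>p, \<plusminus>q, \<plusminus>r\<close>, where \<open>p = 2(a - b)\<close>, \<open>q = 2(b - c)\<close>, \<open>r = 2(c - a)\<close>.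
  Since \<open>p - r = a\<close>, \<open>q - p = b\<close> and \<open>r - q = c\<close>, it has at most one element of \<open>{p, q, r}\<close> and at
  most one of \<open>{-p, -q, -r}\<close>, hence exactly one of each. The pairs \<open>(p, -r)\<close>, \<open>(q, -p)\<close>, \<open>(r, -q)\<close>
  sum to \<open>a, b, c\<close>; the six remaining pairs form two orbits under cyclic permutation of
  \<open>a, b, c\<close>, one for each of the two sets.
\<close>

section \<open>Coordinates and changes of basis in the plane\<close>

lemma vector_2_eq_iff [simp]:
  "(vector [s, t] :: 'a::zero ^ 2) = vector [s', t'] \<longleftrightarrow> s = s' \<and> t = t'"
  by (simp add: vec_eq_iff forall_2)

lemma vector_2_eq_0_iff [simp]: "(vector [s, t] :: 'a::zero ^ 2) = 0 \<longleftrightarrow> s = 0 \<and> t = 0"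
  by (simp add: vec_eq_iff forall_2)

lemma vector_2_add [simp]:
  "(vector [s, t] :: 'a::monoid_add ^ 2) + vector [s', t'] = vector [s + s', t + t']"
  by (simp add: vec_eq_iff forall_2)

lemma vector_2_uminus [simp]: "- (vector [s, t] :: 'a::group_add ^ 2) = vector [- s, - t]"
  by (simp add: vec_eq_iff forall_2)

lemma vector_2_scale [simp]: "k *s (vector [s, t] :: 'a::semiring_1 ^ 2) = vector [k * s, k * t]"
  by (simp add: vec_eq_iff forall_2)

lemma vector_2_cases:
  obtains s t where "(v :: 'a::zero ^ 2) = vector [s, t]"
  by (rule that[of "v $ 1" "v $ 2"]) (simp add: vec_eq_iff forall_2)

text \<open>A kernel vector with nonzero second coordinate would make \<open>b\<close> a multiple of
  \<open>a\<close>, so the map is injective, hence bijective by dimension. It supplies the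
  coordinates in which \<open>a\<close> and \<open>b\<close> become the standard basis.\<close>

lemma linear_frame:
  fixes a b :: "'a::field ^ 2"
  assumes "a \<noteq> 0" and "\<And>k. b \<noteq> k *s a"
  obtains g :: "'a ^ 2 \<Rightarrow> 'a ^ 2" where "Vector_Spaces.linear (*s) (*s) g" "bij g"
    "\<And>s t. g (vector [s, t]) = s *s a + t *s b"
proof
  let ?g = "\<lambda>w :: 'a ^ 2. w $ 1 *s a + w $ 2 *s b"
  show lin: "Vector_Spaces.linear (*s) (*s) ?g"
    by unfold_locales (simp_all add: algebra_simps vec_eq_iff)
  have "w = 0" if "?g w = 0" for w
  proof -
    have "w $ 2 = 0"
    proof (rule ccontr)
      assume nz: "w $ 2 \<noteq> 0"
      have "b = (- w $ 1 / w $ 2) *s a"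
        using that nz by (simp add: vec_eq_iff field_simps add_eq_0_iff)
      with assms(2) show False by blast
    qed
    moreover from this have "w $ 1 = 0"
      using that assms(1) by simp
    ultimately show ?thesis
      by (simp add: vec_eq_iff forall_2)
  qed
  then have "inj ?g"
    using vec.linear_inj_iff_eq_0[OF lin] by blast
  with vec.linear_inj_imp_surj[OF lin] show "bij ?g"
    by (intro bijI)
  show "?g (vector [s, t]) = s *s a + t *s b" for s t
    by simp
qed

lemma linearly_isomorphicI:
  fixes A :: "('a::field ^ 2) set"
  assumes "a \<noteq> 0" "\<And>k. b \<noteq> k *s a" "(\<lambda>w. w $ 1 *s a + w $ 2 *s b) ` A = B"
  shows "linearly_isomorphic A B"
proof -
  obtain g :: "'a ^ 2 \<Rightarrow> 'a ^ 2" where g: "Vector_Spaces.linear (*s) (*s) g" "bij g"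
      "\<And>s t. g (vector [s, t]) = s *s a + t *s b"
    using linear_frame[OF assms(1,2)] by blast
  have "g = (\<lambda>w. w $ 1 *s a + w $ 2 *s b)"
  proof
    fix w show "g w = w $ 1 *s a + w $ 2 *s b"
      by (cases w rule: vector_2_cases) (simp add: g(3))
  qed
  with g assms(3) show ?thesis unfolding linearly_isomorphic_def by blast
qed

section \<open>Linear invariance, and a coordinate criterion for normality\<close>

lemma normal_sum_free_linear_image:
  fixes A :: "('a::field ^ 'n) set" and g :: "'a ^ 'n \<Rightarrow> 'a ^ 'n"
  assumes lin: "Vector_Spaces.linear (*s) (*s) g" and "bij g" and "normal_sum_free A"
  shows "normal_sum_free (g ` A)"
proof -
  interpret g: Vector_Spaces.linear "(*s)" "(*s)" g by (fact lin)
  have inj: "inj g" using \<open>bij g\<close> by (rule bij_is_inj)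
  obtain W v where W: "vec.subspace W" "vec.dim W + 1 = CARD('n)" "0 \<notin> (+) v ` W"
      and A: "sum_free A" "A \<subseteq> (+) v ` W \<union> uminus ` (+) v ` W"
    using assms(3) unfolding normal_sum_free_def affine_hyperplane_def by blast
  have eq: "(+) (g v) ` g ` W = g ` (+) v ` W"
    by (auto simp: image_image g.add)
  have "affine_hyperplane (g ` (+) v ` W)"
    unfolding affine_hyperplane_def
    using W vec.dim_image_eq[OF lin inj_on_subset[OF inj]] eq
    by (intro exI[of _ "g ` W"] exI[of _ "g v"]) (auto simp: g.subspace_image)
  moreover have "0 \<notin> g ` (+) v ` W"
    using W(3) inj g.zero by (metis inj_image_mem_iff)
  moreover have "g ` A \<subseteq> g ` (+) v ` W \<union> uminus ` g ` (+) v ` W"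
  proof -
    have "g ` uminus ` (+) v ` W = uminus ` g ` (+) v ` W"
      by (simp only: image_image g.neg)
    with A(2) show ?thesis by (metis image_Un image_mono)
  qed
  moreover have "sum_free (g ` A)"
    using A(1) inj unfolding sum_free_def by (auto simp: inj_def simp flip: g.add)
  ultimately show ?thesis
    unfolding normal_sum_free_def by blast
qed

lemma linearly_isomorphic_linear_image:
  assumes lin: "Vector_Spaces.linear (*s) (*s) g" and "bij g" and iso: "linearly_isomorphic A B"
  shows "linearly_isomorphic (g ` A) (B :: ('a::field ^ 'n) set)"
proof -
  obtain f where f: "Vector_Spaces.linear (*s) (*s) f" "bij f" "f ` A = B"
    using iso unfolding linearly_isomorphic_def by blast
  obtain h where h: "Vector_Spaces.linear (*s) (*s) h" "h \<circ> g = id"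
    using vec.linear_injective_left_inverse[OF lin] \<open>bij g\<close> bij_is_inj by blast
  have "bij h"
    using h(2) \<open>bij g\<close> by (metis bij_betw_comp_iff bij_id)
  moreover have "h ` g ` A = A"
    using h(2) by (metis image_comp image_id id_apply)
  then have "(f \<circ> h) ` g ` A = B"
    using f(3) by (metis image_comp)
  ultimately show ?thesis
    unfolding linearly_isomorphic_def
    using Vector_Spaces.linear_compose[OF h(1) f(1)] bij_comp[OF _ f(2)] by blast
qed

text \<open>The kernel of the functional \<open>s + e * t\<close> is spanned by
  \<open>(-e, 1)\<close>; its translate by \<open>(1, 0)\<close> is the level line of value
  \<open>1\<close>, and negation carries that line to the one of value \<open>-1\<close>.\<close>

lemma normal_sum_freeI:
  fixes A :: "('a::field ^ 2) set"
  assumes "sum_free A" and e: "e \<noteq> 0"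
    and A: "\<And>s t. vector [s, t] \<in> A \<Longrightarrow> s + e * t = 1 \<or> s + e * t = -1"
  shows "normal_sum_free A"
proof -
  define W where "W = vec.span {vector [- e, 1] :: 'a ^ 2}"
  have "vec.independent {vector [- e, 1] :: 'a ^ 2}"
    by (simp)
  then have dim: "vec.dim W + 1 = CARD(2)"
    unfolding W_def by (simp add: vec.dim_span vec.dim_eq_card_independent)
  let ?H = "(+) (vector [1, 0]) ` W"
  have mem: "vector [s, t] \<in> ?H" if "s + e * t = 1" for s t
  proof -
    have "vector [s, t] = vector [1, 0] + t *s (vector [- e, 1] :: 'a ^ 2)"
      using that by (simp add: algebra_simps)
    then show ?thesis
      unfolding W_def by (metis imageI vec.span_base vec.span_scale singletonI)
  qed
  have "affine_hyperplane ?H"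
    unfolding affine_hyperplane_def using dim vec.subspace_span unfolding W_def by blast
  moreover have "0 \<notin> ?H"
    by (auto simp: W_def vec.span_singleton)
  moreover have "A \<subseteq> ?H \<union> uminus ` ?H"
  proof
    fix v assume "v \<in> A"
    obtain s t where v: "v = vector [s, t]" by (rule vector_2_cases)
    consider "s + e * t = 1" | "- s + e * - t = 1"
      using A[of s t] \<open>v \<in> A\<close> v by (metis minus_add_distrib minus_minus mult_minus_right)
    then show "v \<in> ?H \<union> uminus ` ?H"
    proof cases
      case 1
      then show ?thesis using mem v by blast
    next
      case 2
      then have "- v \<in> ?H" using mem v by simp
      then show ?thesis by (metis UnI2 imageI minus_minus)
    qed
  qed
  ultimately show ?thesis
    unfolding normal_sum_free_def using assms(1) by blast
qed

section \<open>Sum-free sets in general\<close>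

lemma sum_freeD: "sum_free A \<Longrightarrow> x \<in> A \<Longrightarrow> y \<in> A \<Longrightarrow> x + y \<notin> A"
  unfolding sum_free_def by blast

lemma sum_free_linear_vimage:
  assumes "Vector_Spaces.linear (*s) (*s) g" and "sum_free A"
  shows "sum_free (g -` A :: ('a::field ^ 'n) set)"
  using assms unfolding sum_free_def by (auto simp: Vector_Spaces.linear_iff)

text \<open>Both sets \<open>A\<close> and \<open>- A\<close> are sum-free, so the only possible solutions of \<open>x + y = z\<close> in their
  union come from zero-sum triples of \<open>A\<close>.\<close>

lemma sum_free_Un_uminus:
  assumes sf: "sum_free A" and zs: "\<And>x y. x \<in> A \<Longrightarrow> y \<in> A \<Longrightarrow> - (x + y) \<notin> A"
  shows "sum_free (A \<union> uminus ` A :: 'a::ab_group_add set)"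
proof -
  have mem: "v \<in> A \<union> uminus ` A \<longleftrightarrow> v \<in> A \<or> - v \<in> A" for v
    by (metis (no_types) Un_iff image_iff minus_minus)
  have cancel: "(x + y) + - x = y" "(x + y) + - y = x" "- (x + y) + y = - x" "- (x + y) + x = - y"
      "- x + - y = - (x + y)" "- (- x + - y) = x + y" for x y :: 'a
    by (simp_all add: algebra_simps)
  have False if "x \<in> A \<or> - x \<in> A" "y \<in> A \<or> - y \<in> A" "x + y \<in> A \<or> - (x + y) \<in> A" for x y
    using that zs[of x y] zs[of "- x" "- y"]
      sum_freeD[OF sf, of x y] sum_freeD[OF sf, of "- x" "- y"]
      sum_freeD[OF sf, of "x + y" "- x"] sum_freeD[OF sf, of "x + y" "- y"]
      sum_freeD[OF sf, of "- (x + y)" x] sum_freeD[OF sf, of "- (x + y)" y]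
    unfolding cancel minus_minus by blast
  then show ?thesis
    unfolding sum_free_def mem by blast
qed

section \<open>Arithmetic in the field with five elements\<close>

context
  assumes card_5: "CARD('a::field) = 5"
begin

lemma five_eq_0: "(5 :: 'a) = 0"
proof -
  have "CHAR('a) dvd 5" using CHAR_dvd_CARD[where 'a='a] card_5 by simp
  then have "of_nat 5 = (0 :: 'a)" by (simp only: of_nat_eq_0_iff_char_dvd)
  then show ?thesis by simp
qed

text \<open>Reduces numerals to the representatives \<open>0\<close>, \<open>1\<close>,
  \<open>2\<close>, \<open>-1\<close>, \<open>-2\<close> and separates these, so that case checks
  over the field are decided by simplification.\<close>

lemma F5_simps:
  "(2::'a) \<noteq> 0" "(0::'a) \<noteq> 2" "(3::'a) = - 2" "(4::'a) = - 1" "(1::'a) \<noteq> - 1" "(- 1::'a) \<noteq> 1"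
  "(2::'a) \<noteq> - 1" "(- 1::'a) \<noteq> 2" "(2::'a) \<noteq> 1" "(1::'a) \<noteq> 2" "(2::'a) \<noteq> - 2" "(- 2::'a) \<noteq> 2"
  "(1::'a) \<noteq> - 2" "(- 2::'a) \<noteq> 1"
proof -
  show 3: "(3::'a) = - 2" and 4: "(4::'a) = - 1"
    using five_eq_0 by (simp_all add: eq_neg_iff_add_eq_0)
  show 2: "(2::'a) \<noteq> 0"
  proof
    assume "(2::'a) = 0"
    then have "(2::'a) * 2 = 0" by simp
    then show False using 4 by simp
  qed
  then show "(0::'a) \<noteq> 2" by metis
  show "(2::'a) \<noteq> 1" "(1::'a) \<noteq> 2"
    by (metis add_cancel_right_right one_add_one one_neq_zero)+
  show "(1::'a) \<noteq> - 1" "(- 1::'a) \<noteq> 1" "(2::'a) \<noteq> - 1" "(- 1::'a) \<noteq> 2"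
      "(2::'a) \<noteq> - 2" "(- 2::'a) \<noteq> 2" "(1::'a) \<noteq> - 2" "(- 2::'a) \<noteq> 1"
    using 2 by (simp_all add: eq_neg_iff_add_eq_0 neg_eq_iff_add_eq_0 3 4)
qed

lemma F5_cases:
  obtains "(x::'a) = 0" | "x = 1" | "x = 2" | "x = -1" | "x = -2"
proof -
  have "finite (UNIV :: 'a set)" using card_5 by (metis card.infinite zero_neq_numeral)
  moreover have "card {0, 1, 2, -1, -2 :: 'a} = 5"
    by (simp add: card_insert_if F5_simps)
  ultimately have "{0, 1, 2, -1, -2 :: 'a} = UNIV"
    using card_5 by (metis card_subset_eq subset_UNIV)
  with that show thesis by blast
qed

text \<open>The other scalars fail because \<open>0 + 0 = 0\<close>, because
  \<open>2a = a + a\<close>, and because doubling \<open>-2a\<close> gives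
  \<open>-4a = a\<close>.\<close>

lemma scale_mem_sum_free:
  fixes A :: "('a ^ 'n) set"
  assumes sf: "sum_free A" and "a \<in> A" and "k *s a \<in> A"
  shows "k = 1 \<or> k = -1"
proof -
  have "(k + k) *s a \<notin> A" "(1 + 1) *s a \<notin> A"
    using sum_freeD[OF sf assms(2,2)] sum_freeD[OF sf assms(3,3)]
    by (simp_all only: vec.scale_left_distrib vec.scale_one simp_thms)
  then show ?thesis
    using assms(2,3) by (cases k rule: F5_cases) (auto simp: F5_simps)
qed

section \<open>The symmetric case: a functional with values \<open>1\<close> and
  \<open>-1\<close>\<close>

lemma symmetric_sum_free_functional:
  fixes S :: "('a ^ 2) set"
  assumes sf: "sum_free S" and neg: "\<And>v. v \<in> S \<Longrightarrow> - v \<in> S"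
    and e: "vector [1, 0] \<in> S" "vector [0, 1] \<in> S"
  obtains e where "e \<noteq> 0" "\<And>s t. vector [s, t] \<in> S \<Longrightarrow> s + e * t = 1 \<or> s + e * t = -1"
proof -
  define p where "p s t \<longleftrightarrow> vector [s, t] \<in> S" for s t
  have p_add: "\<not> p (s + s') (t + t')" if "p s t" "p s' t'" for s t s' t'
    using sum_freeD[OF sf that[unfolded p_def]] by (simp add: p_def)
  have p_neg: "p (- s) (- t)" if "p s t" for s t
    using neg[OF that[unfolded p_def]] by (simp add: p_def)
  have p_e: "p 1 0" "p 0 1" "p (-1) 0" "p 0 (-1)"
    using e p_neg[of 1 0] p_neg[of 0 1] by (simp_all add: p_def)
  \<comment> \<open>Adding the point to itself or to one of the four unit vectors leaves only these
    exceptions; \<open>minus\<close> is the mirror image under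
    \<open>t \<mapsto> -t\<close>.\<close>
  have plus: "(s, t) \<in> {(2, -2), (-2, 2), (1, 2), (-1, -2), (2, 1), (-2, -1)}"
    if "p s t" "s + t \<noteq> 1" "s + t \<noteq> -1" for s t
    using that p_e p_add[OF that(1,1)] p_add[OF that(1) p_e(1)] p_add[OF that(1) p_e(2)]
      p_add[OF that(1) p_e(3)] p_add[OF that(1) p_e(4)]
    by (cases s rule: F5_cases; cases t rule: F5_cases) (simp_all add: F5_simps)
  have minus: "(s, t) \<in> {(2, 2), (-2, -2), (1, -2), (-1, 2), (2, -1), (-2, 1)}"
    if "p s t" "s - t \<noteq> 1" "s - t \<noteq> -1" for s t
    using that p_e p_add[OF that(1,1)] p_add[OF that(1) p_e(1)] p_add[OF that(1) p_e(2)]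
      p_add[OF that(1) p_e(3)] p_add[OF that(1) p_e(4)]
    by (cases s rule: F5_cases; cases t rule: F5_cases) (simp_all add: F5_simps)
  \<comment> \<open>An exception to \<open>s + t\<close> and an exception to \<open>s - t\<close>
    cannot coexist: up to sign, their sum or difference is a unit vector or one of the two points
    themselves. As the two points are arbitrary, one functional works on all of
    \<open>S\<close>.\<close>
  have "s + t = 1 \<or> s + t = -1 \<or> s' - t' = 1 \<or> s' - t' = -1" if "p s t" "p s' t'" for s t s' t'
  proof (rule ccontr)
    assume *: "\<not> ?thesis"
    show False
      using plus[OF that(1)] minus[OF that(2)] * that p_e p_add[OF that]
        p_add[OF that(1) p_neg[OF that(2)]] p_add[OF p_neg[OF that(1)] that(2)]
      by (auto simp: F5_simps)
  qed
  then consider "\<And>s t. p s t \<Longrightarrow> s + 1 * t = 1 \<or> s + 1 * t = -1"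
    | "\<And>s t. p s t \<Longrightarrow> s + (-1) * t = 1 \<or> s + (-1) * t = -1"
    by (metis mult_1 mult_minus1 diff_conv_add_uminus)
  then show thesis
    using that[of 1] that[of "-1"] by cases (simp_all add: p_def)
qed

section \<open>The case of a zero-sum triple\<close>

lemma sum_free_with_zero_sum:
  fixes Q :: "('a ^ 2) set"
  assumes sf: "sum_free Q" and card: "5 \<le> card Q"
    and e: "vector [1, 0] \<in> Q" "vector [0, 1] \<in> Q" "vector [-1, -1] \<in> Q"
  obtains x y where
    "(x, y) \<in> {(vector [2, -1], vector [-2, 1]), (vector [2, -2], vector [-2, 2]),
        (vector [1, -2], vector [-1, 2]), (vector [2, -1], vector [-1, 2]),
        (vector [1, -2], vector [-2, 2]), (vector [2, -2], vector [-2, 1])}"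
    "Q = {vector [1, 0], vector [0, 1], vector [-1, -1], x, y}"
proof -
  define p where "p s t \<longleftrightarrow> vector [s, t] \<in> Q" for s t
  have p_add: "\<not> p (s + s') (t + t')" if "p s t" "p s' t'" for s t s' t'
    using sum_freeD[OF sf that[unfolded p_def]] by (simp add: p_def)
  have p_e: "p 1 0" "p 0 1" "p (-1) (-1)"
    using e by (simp_all add: p_def)
  \<comment> \<open>With \<open>a\<close>, \<open>b\<close>, \<open>c\<close> the three given
    points, \<open>-a = b + c\<close> and \<open>2a = a + a\<close> are excluded, \<open>-2a\<close>
    doubles to \<open>a\<close>, and \<open>a - b\<close> plus \<open>b\<close> is \<open>a\<close>;
    likewise for the other points. Besides \<open>a\<close>, \<open>b\<close>, \<open>c\<close>,
    only twice the differences remain.\<close>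
  have p_cases: "(s, t) \<in> {(1, 0), (0, 1), (-1, -1)} \<union> {(2, -2), (2, -1), (1, -2)}
      \<union> {(-2, 2), (-2, 1), (-1, 2)}" if "p s t" for s t
    using that p_e p_add[OF p_e(1,1)] p_add[OF p_e(2,2)] p_add[OF p_e(3,3)]
      p_add[OF p_e(1,2)] p_add[OF p_e(1,3)] p_add[OF p_e(2,3)]
      p_add[OF that that] p_add[OF that p_e(1)] p_add[OF that p_e(2)] p_add[OF that p_e(3)]
    by (cases s rule: F5_cases; cases t rule: F5_cases) (simp_all add: F5_simps)
  have excl: "\<not> (p 2 (-2) \<and> p 2 (-1))" "\<not> (p 2 (-1) \<and> p 1 (-2))" "\<not> (p 1 (-2) \<and> p 2 (-2))"
      "\<not> (p (-2) 1 \<and> p (-2) 2)" "\<not> (p (-1) 2 \<and> p (-2) 1)" "\<not> (p (-2) 2 \<and> p (-1) 2)"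
      "\<not> (p 2 (-2) \<and> p (-1) 2)" "\<not> (p 2 (-1) \<and> p (-2) 2)" "\<not> (p 1 (-2) \<and> p (-2) 1)"
    using p_e p_add[of 2 "-2" 0 1] p_add[of 2 "-1" "-1" "-1"] p_add[of 1 "-2" 1 0]
      p_add[of "-2" 1 0 1] p_add[of "-1" 2 "-1" "-1"] p_add[of "-2" 2 1 0]
      p_add[of 2 "-2" "-1" 2] p_add[of 2 "-1" "-2" 2] p_add[of 1 "-2" "-2" 1]
    by (simp_all add: F5_simps) blast+
  let ?P = "{vector [2, -2], vector [2, -1], vector [1, -2]} :: ('a ^ 2) set"
  let ?N = "{vector [-2, 2], vector [-2, 1], vector [-1, 2]} :: ('a ^ 2) set"
  have Q: "v \<in> {vector [1, 0], vector [0, 1], vector [-1, -1]} \<union> ?P \<union> ?N" if "v \<in> Q" for v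
  proof -
    obtain s t where v: "v = vector [s, t]" by (rule vector_2_cases)
    show ?thesis using p_cases[of s t] that by (auto simp: v p_def)
  qed
  \<comment> \<open>If \<open>Q\<close> misses \<open>?P\<close>, any element of \<open>?P\<close>
    serves as \<open>x\<close>; membership of \<open>x\<close> and \<open>y\<close> in
    \<open>Q\<close> follows only from the cardinality bound below.\<close>
  obtain x where x: "x \<in> ?P" "Q \<inter> ?P \<subseteq> {x}"
    using excl unfolding p_def by blast
  obtain y where y: "y \<in> ?N" "Q \<inter> ?N \<subseteq> {y}"
    using excl unfolding p_def by blast
  let ?T = "{vector [1, 0], vector [0, 1], vector [-1, -1], x, y}"
  have "Q \<subseteq> ?T" using Q x(2) y(2) by blast
  moreover have "card ?T \<le> 5"
    using card_length[of "[vector [1, 0], vector [0, 1], vector [-1, -1], x, y]"] by simp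
  ultimately have Q_eq: "Q = ?T"
    using card by (intro card_seteq) auto
  then have "x \<in> Q" "y \<in> Q" by simp_all
  then have "(x, y) \<in> {(vector [2, -1], vector [-2, 1]), (vector [2, -2], vector [-2, 2]),
        (vector [1, -2], vector [-1, 2]), (vector [2, -1], vector [-1, 2]),
        (vector [1, -2], vector [-2, 2]), (vector [2, -2], vector [-2, 1])}"
    using x(1) y(1) excl unfolding p_def by blast
  then show thesis using Q_eq that by blast
qed

text \<open>The first three candidate pairs satisfy \<open>y = -x\<close> and lead to
  \<open>?B\<close>, the other three to \<open>?A\<close>; within each group a cyclic permutation of
  the triple passes from one pair to the next.\<close>

lemma zero_sum_isomorphic:
  fixes Q :: "('a ^ 2) set"
  assumes "sum_free Q" and "5 \<le> card Q"
    and "vector [1, 0] \<in> Q" "vector [0, 1] \<in> Q" "vector [-1, -1] \<in> Q"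
  shows "linearly_isomorphic Q
           {vector [-2, 1], vector [-1, 1], vector [0, 1], vector [1, 1], vector [1, -2]}
       \<or> linearly_isomorphic Q
           {vector [-1, 1], vector [0, 1], vector [1, 1], vector [1, -2], vector [-1, -1]}"
    (is "linearly_isomorphic Q ?A \<or> linearly_isomorphic Q ?B")
proof -
  obtain x y where xy:
    "(x, y) \<in> {(vector [2, -1], vector [-2, 1]), (vector [2, -2], vector [-2, 2]),
        (vector [1, -2], vector [-1, 2]), (vector [2, -1], vector [-1, 2]),
        (vector [1, -2], vector [-2, 2]), (vector [2, -2], vector [-2, 1])}"
    and Q: "Q = {vector [1, 0], vector [0, 1], vector [-1, -1], x, y}"
    using sum_free_with_zero_sum[OF assms] .
  \<comment> \<open>The points \<open>(0, 1)\<close>, \<open>(-1, 1)\<close>, \<open>(1, -2)\<close>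
    form a zero-sum triple in both targets. The frames send the standard basis to two cyclically
    consecutive points of it; each case below uses the frame that sends \<open>x\<close> to
    \<open>(1, 1)\<close>.\<close>
  have frames: "(vector [0, 1] :: 'a ^ 2) \<noteq> 0" "\<And>k. (vector [-1, 1] :: 'a ^ 2) \<noteq> k *s vector [0, 1]"
      "(vector [-1, 1] :: 'a ^ 2) \<noteq> 0" "\<And>k. (vector [1, -2] :: 'a ^ 2) \<noteq> k *s vector [-1, 1]"
      "(vector [1, -2] :: 'a ^ 2) \<noteq> 0" "\<And>k. (vector [0, 1] :: 'a ^ 2) \<noteq> k *s vector [1, -2]"
    by (auto simp: F5_simps)
  note isoI = linearly_isomorphicI[OF frames(1,2), of Q] linearly_isomorphicI[OF frames(3,4), of Q]
    linearly_isomorphicI[OF frames(5,6), of Q]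
  from xy consider
      "x = vector [2, -1]" "y = vector [-2, 1]" | "x = vector [2, -2]" "y = vector [-2, 2]"
    | "x = vector [1, -2]" "y = vector [-1, 2]" | "x = vector [2, -1]" "y = vector [-1, 2]"
    | "x = vector [1, -2]" "y = vector [-2, 2]" | "x = vector [2, -2]" "y = vector [-2, 1]"
    by blast
  then show ?thesis
  proof cases
    case 1
    show ?thesis
      by (rule disjI2, rule isoI(1)) (auto simp: Q 1 F5_simps)
  next
    case 2
    show ?thesis
      by (rule disjI2, rule isoI(2)) (auto simp: Q 2 F5_simps)
  next
    case 3
    show ?thesis
      by (rule disjI2, rule isoI(3)) (auto simp: Q 3 F5_simps)
  next
    case 4
    show ?thesis
      by (rule disjI1, rule isoI(1)) (auto simp: Q 4 F5_simps)
  next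
    case 5
    show ?thesis
      by (rule disjI1, rule isoI(3)) (auto simp: Q 5 F5_simps)
  next
    case 6
    show ?thesis
      by (rule disjI1, rule isoI(2)) (auto simp: Q 6 F5_simps)
  qed
qed

end

section \<open>Reduction of an arbitrary set to coordinates\<close>

theorem theorem1p1:
  fixes A :: "('a::field ^ 2) set"
  assumes "CARD('a) = 5"
    and "sum_free A"
    and "card A \<ge> 5"
    and "\<not> normal_sum_free A"
  shows "linearly_isomorphic A
           {vector [-2, 1], vector [-1, 1], vector [0, 1], vector [1, 1], vector [1, -2]}
       \<or> linearly_isomorphic A
           {vector [-1, 1], vector [0, 1], vector [1, 1], vector [1, -2], vector [-1, -1]}"
proof -
  have nz: "a \<noteq> 0" if "a \<in> A" for a
    using sum_freeD[OF assms(2) that that] that by auto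
  have scale: "k = 1 \<or> k = -1" if "a \<in> A" "k *s a \<in> A" for k a
    using scale_mem_sum_free[OF assms(1,2)] that .
  show ?thesis
  proof (cases "\<exists>a\<in>A. \<exists>b\<in>A. - (a + b) \<in> A")
    case True
    then obtain a b where ab: "a \<in> A" "b \<in> A" "- (a + b) \<in> A" by blast
    \<comment> \<open>Otherwise both \<open>k\<close> and \<open>-(1 + k)\<close> would be
      \<open>1\<close> or \<open>-1\<close>, but \<open>k = 1\<close> gives \<open>-2\<close> and
      \<open>k = -1\<close> gives \<open>0\<close>.\<close>
    have indep: "b \<noteq> k *s a" for k
    proof
      assume b: "b = k *s a"
      then have "- (a + b) = - (1 + k) *s a"
        by (simp add: vec_eq_iff algebra_simps)
      with ab(1,3) scale[of a "- (1 + k)"] have "- (1 + k) = 1 \<or> - (1 + k) = -1" by simp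
      moreover have "k = 1 \<or> k = -1" using ab b scale by blast
      ultimately show False by (auto simp: F5_simps[OF assms(1)])
    qed
    obtain g :: "'a ^ 2 \<Rightarrow> 'a ^ 2" where g: "Vector_Spaces.linear (*s) (*s) g" "bij g"
        "\<And>s t. g (vector [s, t]) = s *s a + t *s b"
      using linear_frame[OF nz[OF ab(1)] indep] by blast
    have "card (g -` A) = card A"
      using g(2) by (simp add: card_vimage_inj bij_is_inj bij_is_surj)
    then have "linearly_isomorphic (g -` A)
           {vector [-2, 1], vector [-1, 1], vector [0, 1], vector [1, 1], vector [1, -2]}
       \<or> linearly_isomorphic (g -` A)
           {vector [-1, 1], vector [0, 1], vector [1, 1], vector [1, -2], vector [-1, -1]}"
      using assms(3) ab
      by (intro zero_sum_isomorphic[OF assms(1) sum_free_linear_vimage[OF g(1) assms(2)]])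
        (simp_all add: g(3))
    then show ?thesis
      using linearly_isomorphic_linear_image[OF g(1,2), of "g -` A"] g(2)
      by (auto simp: surj_image_vimage_eq bij_is_surj)
  next
    case False
    obtain a where a: "a \<in> A" using assms(3) by fastforce
    \<comment> \<open>On the line through \<open>a\<close> and the origin, \<open>A\<close> has at
      most the two points \<open>a\<close> and \<open>-a\<close>, so five elements force one off
      it.\<close>
    obtain b where b: "b \<in> A" "\<And>k. b \<noteq> k *s a"
    proof (rule ccontr)
      assume "\<not> thesis"
      then have "A \<subseteq> {a, - a}" using that scale[OF a] by fastforce
      then have "card A \<le> card {a, - a}" by (intro card_mono) auto
      also have "\<dots> \<le> 2" by (simp add: card_insert_if)
      finally show False using assms(3) by simp
    qed
    obtain g :: "'a ^ 2 \<Rightarrow> 'a ^ 2" where g: "Vector_Spaces.linear (*s) (*s) g" "bij g"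
        "\<And>s t. g (vector [s, t]) = s *s a + t *s b"
      using linear_frame[OF nz[OF a] b(2)] by blast
    have g_neg: "g (- v) = - g v" for v
      using g(1) by (rule vec.linear_neg)
    \<comment> \<open>The functional is found for the symmetrized set and then restricted to
      \<open>A\<close>.\<close>
    have "sum_free (g -` (A \<union> uminus ` A))"
      using False by (intro sum_free_linear_vimage[OF g(1)] sum_free_Un_uminus assms(2)) blast
    then obtain e where e: "e \<noteq> 0"
        "\<And>s t. vector [s, t] \<in> g -` (A \<union> uminus ` A) \<Longrightarrow> s + e * t = 1 \<or> s + e * t = -1"
      by (rule symmetric_sum_free_functional[OF assms(1)]) (use a b g_neg g(3) in auto)
    have "normal_sum_free (g -` A)"
      using e by (intro normal_sum_freeI[of _ e] sum_free_linear_vimage[OF g(1) assms(2)]) auto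
    then have "normal_sum_free A"
      using normal_sum_free_linear_image[OF g(1,2), of "g -` A"] g(2)
      by (simp add: surj_image_vimage_eq bij_is_surj)
    with assms(4) show ?thesis by contradiction
  qed
qed

end
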